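(* Let $n\geqslant 2$ and let $X\in\mathfrak{so}(n)$ be non-zero, with non-zero eigenvalues $\pm i\lambda_1,\pm i\lambda_2,\ldots,\pm i\lambda_\ell$ (where the $\lambda_j$ are real). The one-parameter subgroup $\phi_X:\mathbb{R}\to SO(n)$, $\phi_X(t)=e^{tX}$, is non-injective if and only if $\lambda_1,\lambda_2,\ldots,\lambda_\ell$ are either all rational numbers or all rational multiples of the same irrational number.
   Context: $\mathfrak{so}(n)$ is the Lie algebra of $SO(n)$: real skew-symmetric $n\times n$ matrices. *)

theory Defs
  imports "HOL-Analysis.Analysis"
begin

definition so_algebra :: "(real ^ 'n ^ 'n) set" where
  "so_algebra = {X. transpose X = - X}"

definition SO_group :: "(real ^ 'n ^ 'n) set" where
  "SO_group = {Q. rotation_matrix Q}"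

(* The class operations "*" and "^" on vec types act componentwise, so powers and the
   exponential of a matrix have to be built from the matrix product "**". *)

primrec matrix_power :: "'a::semiring_1 ^ 'n ^ 'n \<Rightarrow> nat \<Rightarrow> 'a ^ 'n ^ 'n" where
  "matrix_power A 0 = mat 1"
| "matrix_power A (Suc k) = A ** matrix_power A k"

definition matrix_exp :: "real ^ 'n ^ 'n \<Rightarrow> real ^ 'n ^ 'n" where
  "matrix_exp A = (\<Sum>k. (1 / fact k) *\<^sub>R matrix_power A k)"

definition one_param_subgroup :: "real ^ 'n ^ 'n \<Rightarrow> real \<Rightarrow> real ^ 'n ^ 'n" where
  "one_param_subgroup X t = matrix_exp (t *\<^sub>R X)"

definition complex_matrix :: "real ^ 'n ^ 'm \<Rightarrow> complex ^ 'n ^ 'm" where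
  "complex_matrix A = (\<chi> i j. complex_of_real (A $ i $ j))"

definition matrix_eigenvalue :: "'a::field ^ 'n ^ 'n \<Rightarrow> 'a \<Rightarrow> bool" where
  "matrix_eigenvalue A \<mu> \<longleftrightarrow> (\<exists>v. v \<noteq> 0 \<and> A *v v = \<mu> *s v)"


lemma matrix_power_entry_bound:
  fixes A :: "real ^ 'n ^ 'n"
  shows "\<bar>matrix_power A k $ i $ j\<bar> \<le> (real CARD('n) * norm A) ^ k"
proof (induction k arbitrary: i j)
  case 0
  then show ?case by (simp add: mat_def)
next
  case (Suc k)
  have entry: "\<bar>A $ i $ m\<bar> \<le> norm A" for m
    by (metis Finite_Cartesian_Product.norm_nth_le order_trans real_norm_def)
  have "\<bar>matrix_power A (Suc k) $ i $ j\<bar> = \<bar>\<Sum>m\<in>UNIV. A $ i $ m * matrix_power A k $ m $ j\<bar>"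
    by (simp add: matrix_matrix_mult_def)
  also have "\<dots> \<le> (\<Sum>m\<in>UNIV. \<bar>A $ i $ m * matrix_power A k $ m $ j\<bar>)"
    by (rule sum_abs)
  also have "\<dots> \<le> (\<Sum>m\<in>(UNIV :: 'n set). norm A * (real CARD('n) * norm A) ^ k)"
    unfolding abs_mult by (intro sum_mono mult_mono entry Suc.IH) auto
  also have "\<dots> = (real CARD('n) * norm A) ^ Suc k" by simp
  finally show ?case .
qed

lemma summable_matrix_exp_entry:
  fixes A :: "real ^ 'n ^ 'n"
  shows "summable (\<lambda>k. norm (matrix_power A k $ i $ j / fact k))"
proof (rule summable_comparison_test')
  show "summable (\<lambda>k. inverse (fact k) * (real CARD('n) * norm A) ^ k)"
    by (rule summable_exp)
  show "norm (norm (matrix_power A k $ i $ j / fact k))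
      \<le> inverse (fact k) * (real CARD('n) * norm A) ^ k" if "0 \<le> k" for k
    using matrix_power_entry_bound[of A k i j] by (simp add: field_simps)
qed

lemma matrix_exp_sums:
  fixes A :: "real ^ 'n ^ 'n"
  shows "(\<lambda>k. (1 / fact k) *\<^sub>R matrix_power A k) sums matrix_exp A"
proof -
  define L :: "real ^ 'n ^ 'n" where "L = (\<chi> i j. \<Sum>k. matrix_power A k $ i $ j / fact k)"
  have "(\<lambda>k. (1 / fact k) *\<^sub>R matrix_power A k) sums L"
    unfolding sums_def
  proof (intro vec_tendstoI)
    fix i j
    have "(\<lambda>k. matrix_power A k $ i $ j / fact k) sums (L $ i $ j)"
      using summable_sums[OF summable_norm_cancel[OF summable_matrix_exp_entry[of A i j]]]
      by (simp add: L_def)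
    then show "(\<lambda>n. (\<Sum>k<n. (1 / fact k) *\<^sub>R matrix_power A k) $ i $ j) \<longlonglongrightarrow> L $ i $ j"
      by (simp add: sums_def)
  qed
  then show ?thesis
    unfolding matrix_exp_def by (simp add: sums_iff)
qed

lemma matrix_exp_entry_sums:
  "(\<lambda>k. matrix_power A k $ i $ j / fact k) sums (matrix_exp A $ i $ j)"
  using sums_vec_nth[OF sums_vec_nth[OF matrix_exp_sums[of A], of i], of j] by simp

lemma matrix_exp_entry: "matrix_exp A $ i $ j = (\<Sum>k. matrix_power A k $ i $ j / fact k)"
  using matrix_exp_entry_sums[of A i j] by (simp add: sums_iff)

lemma matrix_power_add: "matrix_power A (m + n) = matrix_power A m ** matrix_power A n"
  by (induction m) (simp_all add: matrix_mul_assoc)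

lemma matrix_power_scaleR:
  fixes A :: "real ^ 'n ^ 'n"
  shows "matrix_power (t *\<^sub>R A) k = t ^ k *\<^sub>R matrix_power A k"
  by (induction k)
    (simp_all add: matrix_scalar_ac mult.commute flip: scalar_matrix_assoc)

lemma matrix_power_commute: "A ** matrix_power A k = matrix_power A k ** A"
  by (induction k) (auto, metis matrix_mul_assoc)

lemma matrix_power_transpose:
  fixes A :: "real ^ 'n ^ 'n"
  shows "matrix_power (transpose A) k = transpose (matrix_power A k)"
  by (induction k) (simp_all add: matrix_transpose_mul transpose_mat
      flip: matrix_power_commute matrix_transpose_mul)

lemma matrix_exp_transpose: "matrix_exp (transpose A) = transpose (matrix_exp A)"
  by (simp add: vec_eq_iff matrix_exp_entry matrix_power_transpose)
    (simp add: transpose_def matrix_exp_entry)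

lemma one_param_subgroup_0 [simp]:
  fixes X :: "real ^ 'n ^ 'n"
  shows "one_param_subgroup X 0 = mat 1"
proof -
  have "matrix_power (0 :: real ^ 'n ^ 'n) k = 0" if "k \<noteq> 0" for k
    using that by (cases k) auto
  then have "(\<lambda>k. (1 / fact k) *\<^sub>R matrix_power (0 :: real ^ 'n ^ 'n) k) sums
      (\<Sum>k\<in>{0}. (1 / fact k) *\<^sub>R matrix_power (0 :: real ^ 'n ^ 'n) k)"
    by (intro sums_finite) auto
  then show ?thesis
    by (simp add: one_param_subgroup_def matrix_exp_def sums_iff)
qed

lemma one_param_subgroup_add:
  fixes X :: "real ^ 'n ^ 'n"
  shows "one_param_subgroup X (s + t) = one_param_subgroup X s ** one_param_subgroup X t"
proof -
  have "(one_param_subgroup X s ** one_param_subgroup X t) $ i $ j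
      = one_param_subgroup X (s + t) $ i $ j" for i j
  proof -
    let ?a = "\<lambda>m k. matrix_power (s *\<^sub>R X) k $ i $ m / fact k"
    let ?b = "\<lambda>m k. matrix_power (t *\<^sub>R X) k $ m $ j / fact k"
    have "(\<lambda>k. \<Sum>m\<in>UNIV. \<Sum>p\<le>k. ?a m p * ?b m (k - p)) sums
        (\<Sum>m\<in>UNIV. (\<Sum>k. ?a m k) * (\<Sum>k. ?b m k))"
      by (intro sums_sum Cauchy_product_sums summable_matrix_exp_entry)
    moreover have "(\<Sum>m\<in>UNIV. (\<Sum>k. ?a m k) * (\<Sum>k. ?b m k))
        = (one_param_subgroup X s ** one_param_subgroup X t) $ i $ j"
      by (simp add: matrix_matrix_mult_def one_param_subgroup_def matrix_exp_entry)
    moreover have "(\<Sum>m\<in>UNIV. \<Sum>p\<le>k. ?a m p * ?b m (k - p))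
        = matrix_power ((s + t) *\<^sub>R X) k $ i $ j / fact k" for k
    proof -
      have "(\<Sum>m\<in>UNIV. \<Sum>p\<le>k. ?a m p * ?b m (k - p))
          = (\<Sum>p\<le>k. \<Sum>m\<in>UNIV. ?a m p * ?b m (k - p))"
        by (rule sum.swap)
      also have "\<dots> = (\<Sum>p\<le>k. s ^ p * t ^ (k - p) / (fact p * fact (k - p))
          * (matrix_power X p ** matrix_power X (k - p)) $ i $ j)"
        by (intro sum.cong refl)
          (simp add: matrix_matrix_mult_def matrix_power_scaleR sum_distrib_left mult_ac)
      also have "\<dots> = (\<Sum>p\<le>k. s ^ p * t ^ (k - p) / (fact p * fact (k - p))
          * matrix_power X k $ i $ j)"
        by (intro sum.cong refl) (simp flip: matrix_power_add)
      also have "\<dots> = (\<Sum>p\<le>k. real (k choose p) * s ^ p * t ^ (k - p))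
          / fact k * matrix_power X k $ i $ j"
        unfolding sum_distrib_right sum_divide_distrib
        by (intro sum.cong refl) (simp add: binomial_fact)
      also have "\<dots> = matrix_power ((s + t) *\<^sub>R X) k $ i $ j / fact k"
        by (simp add: matrix_power_scaleR binomial_ring[of s t k])
      finally show ?thesis .
    qed
    ultimately show ?thesis
      by (simp add: sums_iff one_param_subgroup_def matrix_exp_entry)
  qed
  then show ?thesis by (simp add: vec_eq_iff)
qed

lemma one_param_subgroup_in_SO_group:
  assumes "X \<in> so_algebra"
  shows "one_param_subgroup X t \<in> SO_group"
proof -
  have orth: "orthogonal_matrix (one_param_subgroup X s)" for s
  proof -
    have "transpose (one_param_subgroup X s) = one_param_subgroup X (- s)"
      using assms
      by (simp add: one_param_subgroup_def so_algebra_def transpose_scalar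
          flip: matrix_exp_transpose)
    then show ?thesis
      using one_param_subgroup_add[of X "- s" s] by (simp add: orthogonal_matrix)
  qed
  have "one_param_subgroup X t = one_param_subgroup X (t / 2) ** one_param_subgroup X (t / 2)"
    using one_param_subgroup_add[of X "t / 2" "t / 2"] by simp
  then have "det (one_param_subgroup X t) = (det (one_param_subgroup X (t / 2)))\<^sup>2"
    by (metis det_mul power2_eq_square)
  moreover have "(det (one_param_subgroup X (t / 2)))\<^sup>2 = 1"
    using det_orthogonal_matrix[OF orth[of "t / 2"]] by auto
  ultimately show ?thesis
    using orth by (simp add: SO_group_def rotation_matrix_def)
qed

end

theory Submission
  imports Defs "HOL-Computational_Algebra.Fundamental_Theorem_Algebra"
begin

text \<open>
  Everything rests on one criterion: for \<open>X\<close> skew-symmetric, \<open>e\<^sup>T\<^sup>X = 1\<close> holds if and only if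
  \<open>e\<^sup>T\<^sup>\<mu> = 1\<close> for every complex eigenvalue \<open>\<mu>\<close> of \<open>X\<close>
  (\<open>one_param_subgroup_eq_mat_1_iff\<close>). As \<open>\<phi>\<^sub>X\<close> is a homomorphism, it fails to be injective
  exactly when such a \<open>T \<noteq> 0\<close> exists. For the eigenvalues \<open>\<plusminus>i\<lambda>\<^sub>j\<close> the criterion says that
  every \<open>T\<lambda>\<^sub>j\<close> is an integer multiple of \<open>2\<pi>\<close>. Given \<open>T\<close>, all \<open>\<lambda>\<^sub>j\<close> are therefore integer
  multiples of \<open>2\<pi>/T\<close>, and which alternative of the theorem occurs depends on whether this
  number is rational. Conversely, if \<open>\<lambda>\<^sub>j = q\<^sub>j\<alpha>\<close> with \<open>q\<^sub>j\<close> rational and \<open>\<alpha> \<noteq> 0\<close>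
  (\<open>\<alpha> = 1\<close> in the first alternative), and \<open>N\<close> is a common denominator of the \<open>q\<^sub>j\<close>,
  then \<open>T = 2\<pi>N/\<alpha>\<close> works.

  The necessity in the criterion is clear, since \<open>e\<^sup>T\<^sup>X\<close> acts on an eigenvector for \<open>\<mu>\<close> as
  \<open>e\<^sup>T\<^sup>\<mu>\<close>. For sufficiency one could diagonalise \<open>X\<close>, but a shorter argument avoids it. Put
  \<open>Y = e\<^sup>T\<^sup>X\<close>. The range of \<open>Y - 1\<close> on complex vectors is invariant under \<open>X\<close>. If it were
  nonzero it would contain an eigenvector \<open>w\<close> of \<open>X\<close>
  (\<open>eigenvector_in_invariant_subspace\<close>), and the assumption on the eigenvalues gives
  \<open>Y w = w\<close>. But \<open>Y\<close> is orthogonal, so its fixed vectors are orthogonal to the range of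
  \<open>Y - 1\<close>, whence \<open>w = 0\<close>, a contradiction.
\<close>

section \<open>Eigenvectors in invariant subspaces\<close>

text \<open>
  More vectors than the real dimension of the space satisfy a linear relation; for a
  sequence, repetitions are also relations. The coefficients of the relation form a polynomial.
\<close>

lemma exists_poly_relation:
  fixes f :: "nat \<Rightarrow> complex ^ 'n"
  shows "\<exists>p. p \<noteq> 0 \<and> (\<Sum>i\<le>degree p. coeff p i *s f i) = 0"
proof -
  define N where "N = DIM(complex ^ 'n)"
  obtain c :: "nat \<Rightarrow> real" where c: "(\<Sum>i\<le>N. c i *\<^sub>R f i) = 0" "\<exists>i\<le>N. c i \<noteq> 0"
  proof (cases "inj_on f {..N}")
    case True
    then have "card (f ` {..N}) > DIM(complex ^ 'n)"
      by (simp add: card_image N_def)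
    then have "dependent (f ` {..N})"
      using dependent_biggerset by blast
    then obtain u where u: "\<exists>v\<in>f ` {..N}. u v \<noteq> 0" "(\<Sum>v\<in>f ` {..N}. u v *\<^sub>R v) = 0"
      using dependent_finite[of "f ` {..N}"] by auto
    have "(\<Sum>i\<le>N. u (f i) *\<^sub>R f i) = 0"
      using u(2) by (simp add: sum.reindex[OF True])
    then show ?thesis
      using u(1) by (intro that[of "u \<circ> f"]) auto
  next
    case False
    then obtain i j where ij: "i \<le> N" "j \<le> N" "i \<noteq> j" "f i = f j"
      by (auto simp: inj_on_def)
    define c :: "nat \<Rightarrow> real" where "c k = (if k = i then 1 else 0) - (if k = j then 1 else 0)" for k
    have "(\<Sum>k\<le>N. c k *\<^sub>R f k) =
        (\<Sum>k\<le>N. if k = i then f k else 0) - (\<Sum>k\<le>N. if k = j then f k else 0)"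
      unfolding sum_subtractf[symmetric] by (rule sum.cong) (auto simp: c_def)
    also have "\<dots> = 0"
      using ij by simp
    finally show ?thesis
      using ij by (intro that[of c]) (auto simp: c_def intro!: exI[of _ i])
  qed
  define p :: "complex poly" where "p = (\<Sum>i\<le>N. monom (of_real (c i)) i)"
  have coeff: "coeff p k = (if k \<le> N then of_real (c k) else 0)" for k
    by (simp add: p_def coeff_sum)
  have "p \<noteq> 0"
    using c(2) coeff by (metis coeff_0 of_real_eq_0_iff)
  moreover have "degree p \<le> N"
    by (rule degree_le) (simp add: coeff)
  then have "(\<Sum>i\<le>degree p. coeff p i *s f i) = (\<Sum>i\<le>N. coeff p i *s f i)"
    by (intro sum.mono_neutral_left) (auto simp: coeff_eq_0)
  moreover have "\<dots> = (\<Sum>i\<le>N. c i *\<^sub>R f i)"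
    by (rule sum.cong) (auto simp: coeff vec_eq_iff scaleR_conv_of_real[where 'a = complex])
  ultimately show ?thesis
    using c(1) by auto
qed

text \<open>
  Pick a nonzero \<open>w\<close> in the subspace, and let \<open>p\<close> be a polynomial of least degree among
  the nonzero ones with \<open>p(A) w = 0\<close>. It has a
  root \<open>\<mu>\<close>, and if \<open>p = (x - \<mu>) q\<close>, then \<open>q(A) w\<close> is nonzero by minimality and is
  annihilated by \<open>A - \<mu>\<close>.
\<close>

lemma eigenvector_in_invariant_subspace:
  fixes A :: "complex ^ 'n ^ 'n"
  assumes W: "vec.subspace W" and inv: "\<And>v. v \<in> W \<Longrightarrow> A *v v \<in> W"
    and w: "w \<in> W" "w \<noteq> 0"
  shows "\<exists>v\<in>W. \<exists>\<mu>. v \<noteq> 0 \<and> A *v v = \<mu> *s v"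
proof -
  define f where "f i = ((\<lambda>v. A *v v) ^^ i) w" for i
  define ev where "ev p = (\<Sum>i\<le>degree p. coeff p i *s f i)" for p :: "complex poly"
  have f_Suc: "A *v f i = f (Suc i)" for i
    by (simp add: f_def)
  have f_W: "f i \<in> W" for i
    by (induction i) (simp_all add: f_def w inv)
  have ev_W: "ev p \<in> W" for p
    unfolding ev_def by (intro vec.subspace_sum vec.subspace_scale W f_W)
  obtain p0 where "p0 \<noteq> 0 \<and> ev p0 = 0"
    using exists_poly_relation[of f] unfolding ev_def by blast
  from ex_has_least_nat[of "\<lambda>p. p \<noteq> 0 \<and> ev p = 0", OF this, of degree]
  obtain p where p: "p \<noteq> 0" "ev p = 0"
    and min: "\<And>q. q \<noteq> 0 \<Longrightarrow> ev q = 0 \<Longrightarrow> degree p \<le> degree q"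
    by blast
  have "degree p \<noteq> 0"
  proof
    assume "degree p = 0"
    then have "ev p = coeff p 0 *s w" "coeff p 0 \<noteq> 0"
      using p(1) leading_coeff_0_iff[of p] by (simp_all add: ev_def f_def)
    then show False
      using p(2) w(2) by simp
  qed
  then obtain \<mu> where "poly p \<mu> = 0"
    using fundamental_theorem_of_algebra[of p] by (auto simp: constant_degree)
  then obtain q where q: "p = [:- \<mu>, 1:] * q"
    by (auto simp: poly_eq_0_iff_dvd dvd_def)
  have "q \<noteq> 0"
    using p(1) q by auto
  have deg: "degree p = Suc (degree q)"
    unfolding q using \<open>q \<noteq> 0\<close> by (subst degree_mult_eq) auto
  have "ev q \<noteq> 0"
    using min[OF \<open>q \<noteq> 0\<close>] deg by auto
  have p_shift: "p = pCons 0 q - smult \<mu> q"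
    by (simp add: q)
  have "ev p = (\<Sum>i\<le>Suc (degree q). coeff (pCons 0 q) i *s f i)
      - (\<Sum>i\<le>Suc (degree q). (\<mu> * coeff q i) *s f i)"
    unfolding ev_def deg sum_subtractf[symmetric]
    by (rule sum.cong) (simp_all add: p_shift vec.scale_left_diff_distrib)
  also have "(\<Sum>i\<le>Suc (degree q). coeff (pCons 0 q) i *s f i)
      = (\<Sum>i\<le>degree q. coeff q i *s f (Suc i))"
    by (subst sum.atMost_Suc_shift) simp
  also have "\<dots> = A *v ev q"
    by (simp add: ev_def vec.linear_sum[OF matrix_vector_mul_linear_gen]
        vec.linear_scale[OF matrix_vector_mul_linear_gen] f_Suc)
  also have "(\<Sum>i\<le>Suc (degree q). (\<mu> * coeff q i) *s f i) = \<mu> *s ev q"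
    by (simp add: coeff_eq_0 ev_def vec.scale_sum_right)
  finally have "A *v ev q = \<mu> *s ev q"
    using p(2) by simp
  then show ?thesis
    using \<open>ev q \<noteq> 0\<close> ev_W by blast
qed

section \<open>The action of the one-parameter subgroup on complex vectors\<close>

lemma complex_matrix_mul:
  "complex_matrix (A ** B) = complex_matrix A ** complex_matrix B"
  by (simp add: complex_matrix_def matrix_matrix_mult_def vec_eq_iff)

lemma complex_matrix_mat_1: "complex_matrix (mat 1) = mat 1"
  by (simp add: complex_matrix_def mat_def vec_eq_iff)

lemma complex_matrix_eq_iff: "complex_matrix A = complex_matrix B \<longleftrightarrow> A = B"
  by (simp add: complex_matrix_def vec_eq_iff)

lemma Re_complex_matrix_mult:
  "(\<chi> i. Re ((complex_matrix A *v v) $ i)) = A *v (\<chi> i. Re (v $ i))"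
  by (simp add: complex_matrix_def matrix_vector_mult_def vec_eq_iff)

lemma Im_complex_matrix_mult:
  "(\<chi> i. Im ((complex_matrix A *v v) $ i)) = A *v (\<chi> i. Im (v $ i))"
  by (simp add: complex_matrix_def matrix_vector_mult_def vec_eq_iff)

lemma matrix_power_eigenvector:
  assumes "complex_matrix X *v v = \<mu> *s v"
  shows "complex_matrix (matrix_power X k) *v v = \<mu> ^ k *s v"
proof (induction k)
  case 0
  then show ?case by (simp add: complex_matrix_mat_1)
next
  case (Suc k)
  then show ?case
    using assms
    by (simp add: complex_matrix_mul mult.commute flip: matrix_vector_mul_assoc)
      (simp add: vec.linear_scale[OF matrix_vector_mul_linear_gen])
qed

lemma one_param_subgroup_eigenvector:
  fixes X :: "real ^ 'n ^ 'n"
  assumes "complex_matrix X *v v = \<mu> *s v"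
  shows "complex_matrix (one_param_subgroup X t) *v v = exp (of_real t * \<mu>) *s v"
proof -
  have "(complex_matrix (one_param_subgroup X t) *v v) $ i = exp (of_real t * \<mu>) * v $ i" for i
  proof -
    have "(\<lambda>k. \<Sum>j\<in>UNIV. complex_of_real (matrix_power (t *\<^sub>R X) k $ i $ j / fact k) * v $ j)
        sums (\<Sum>j\<in>UNIV. complex_of_real (one_param_subgroup X t $ i $ j) * v $ j)"
      unfolding one_param_subgroup_def
      by (intro sums_sum sums_mult2 sums_of_real matrix_exp_entry_sums)
    moreover have
      "(\<Sum>j\<in>UNIV. complex_of_real (matrix_power (t *\<^sub>R X) k $ i $ j / fact k) * v $ j)
        = (of_real t * \<mu>) ^ k /\<^sub>R fact k * v $ i" (is "?L = ?R") for k
    proof -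
      have "?L = of_real t ^ k / fact k * (complex_matrix (matrix_power X k) *v v) $ i"
        by (simp add: matrix_power_scaleR complex_matrix_def matrix_vector_mult_def
            sum_distrib_left mult_ac)
      also have "\<dots> = ?R"
        by (simp add: matrix_power_eigenvector[OF assms] scaleR_conv_of_real
            power_mult_distrib field_simps)
      finally show ?thesis .
    qed
    moreover have "(\<lambda>k. (of_real t * \<mu>) ^ k /\<^sub>R fact k * v $ i)
        sums (exp (of_real t * \<mu>) * v $ i)"
      by (intro sums_mult2 exp_converges)
    ultimately show ?thesis
      by (simp add: sums_iff complex_matrix_def matrix_vector_mult_def)
  qed
  then show ?thesis
    by (simp add: vec_eq_iff)
qed

lemma one_param_subgroup_commute:
  fixes X :: "real ^ 'n ^ 'n"
  shows "X ** one_param_subgroup X t = one_param_subgroup X t ** X"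
proof -
  let ?M = "\<lambda>k. (1 / fact k) *\<^sub>R matrix_power (t *\<^sub>R X) k"
  have "bounded_linear (\<lambda>M. X ** M)" "bounded_linear (\<lambda>M. M ** X)"
    unfolding linear_conv_bounded_linear[symmetric]
    by (auto intro!: linearI simp: vec_eq_iff matrix_matrix_mult_def sum.distrib
        distrib_left distrib_right sum_distrib_left mult_ac)
  then have "(\<lambda>k. X ** ?M k) sums (X ** one_param_subgroup X t)"
    "(\<lambda>k. ?M k ** X) sums (one_param_subgroup X t ** X)"
    unfolding one_param_subgroup_def by (auto intro: bounded_linear.sums matrix_exp_sums)
  moreover have "X ** ?M k = ?M k ** X" for k
    by (simp add: matrix_power_scaleR matrix_scalar_ac matrix_power_commute
        flip: scalar_matrix_assoc)
  ultimately show ?thesis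
    by (simp add: sums_iff)
qed

section \<open>When the exponential is the identity\<close>

text \<open>
  An orthogonal \<open>Q\<close> preserves inner products, so a fixed vector \<open>w\<close> of \<open>Q\<close> satisfies
  \<open>\<langle>w, Q u\<rangle> = \<langle>Q w, Q u\<rangle> = \<langle>w, u\<rangle>\<close> and is orthogonal to \<open>Q u - u\<close>. Taking
  \<open>w = Q u - u\<close> gives the claim.
\<close>

lemma orthogonal_matrix_fixed_difference:
  fixes Q :: "real ^ 'n ^ 'n"
  assumes Q: "orthogonal_matrix Q" and fixed: "Q *v (Q *v u - u) = Q *v u - u"
  shows "Q *v u = u"
proof -
  have "orthogonal_transformation (\<lambda>v. Q *v v)"
    using Q by (simp add: orthogonal_transformation_matrix)
  then have "(Q *v (Q *v u - u)) \<bullet> (Q *v u) = (Q *v u - u) \<bullet> u"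
    by (simp add: orthogonal_transformation_def)
  then have "(Q *v u - u) \<bullet> (Q *v u - u) = 0"
    by (simp add: fixed inner_diff_right)
  then show ?thesis
    by simp
qed

lemma complex_orthogonal_matrix_fixed_difference:
  fixes Q :: "real ^ 'n ^ 'n"
  defines "C \<equiv> complex_matrix Q"
  assumes Q: "orthogonal_matrix Q" and fixed: "C *v (C *v u - u) = C *v u - u"
  shows "C *v u = u"
proof -
  define R I where "R v = (\<chi> i. Re (v $ i))" and "I v = (\<chi> i. Im (v $ i))"
    for v :: "complex ^ 'n"
  have RI: "R (C *v v) = Q *v R v" "I (C *v v) = Q *v I v"
    "R (v - v') = R v - R v'" "I (v - v') = I v - I v'" for v v'
    unfolding R_def I_def C_def Re_complex_matrix_mult Im_complex_matrix_mult
    by (simp_all add: vec_eq_iff)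
  have "Q *v R u = R u"
    using arg_cong[OF fixed, of R] unfolding RI
    by (rule orthogonal_matrix_fixed_difference[OF Q])
  moreover have "Q *v I u = I u"
    using arg_cong[OF fixed, of I] unfolding RI
    by (rule orthogonal_matrix_fixed_difference[OF Q])
  ultimately have "R (C *v u) = R u" "I (C *v u) = I u"
    by (simp_all only: RI)
  then show ?thesis
    by (simp add: R_def I_def vec_eq_iff complex_eq_iff)
qed

text \<open>
  For the converse direction, an eigenvector of \<open>X\<close> in the range of \<open>Y - 1\<close>, where
  \<open>Y = e\<^sup>t\<^sup>X\<close>, would be fixed by \<open>Y\<close>, which orthogonality of \<open>Y\<close> excludes; so this range
  is zero.
\<close>

lemma one_param_subgroup_eq_mat_1_iff:
  fixes X :: "real ^ 'n ^ 'n"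
  assumes X: "X \<in> so_algebra"
  shows "one_param_subgroup X t = mat 1 \<longleftrightarrow>
    (\<forall>\<mu>. matrix_eigenvalue (complex_matrix X) \<mu> \<longrightarrow> exp (of_real t * \<mu>) = 1)"
proof (intro iffI allI impI)
  fix \<mu>
  assume "one_param_subgroup X t = mat 1" "matrix_eigenvalue (complex_matrix X) \<mu>"
  then obtain v where "v \<noteq> 0" "complex_matrix X *v v = \<mu> *s v"
    by (auto simp: matrix_eigenvalue_def)
  moreover from this(2) have "exp (of_real t * \<mu>) *s v = 1 *s v"
    using one_param_subgroup_eigenvector[of X v \<mu> t] \<open>one_param_subgroup X t = mat 1\<close>
    by (simp add: complex_matrix_mat_1)
  ultimately show "exp (of_real t * \<mu>) = 1"
    using vec.scale_cancel_right by blast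
next
  assume ev: "\<forall>\<mu>. matrix_eigenvalue (complex_matrix X) \<mu> \<longrightarrow> exp (of_real t * \<mu>) = 1"
  define Y where "Y = one_param_subgroup X t"
  define C A where "C = complex_matrix Y" and "A = complex_matrix X"
  define W where "W = range (\<lambda>u. C *v u - u)"
  have orth: "orthogonal_matrix Y"
    using one_param_subgroup_in_SO_group[OF X]
    by (simp add: Y_def SO_group_def rotation_matrix_def)
  have comm: "A *v (C *v u) = C *v (A *v u)" for u
    by (simp add: A_def C_def Y_def matrix_vector_mul_assoc one_param_subgroup_commute
        flip: complex_matrix_mul)
  have W: "vec.subspace W"
  proof (rule vec.subspaceI)
    show "0 \<in> W"
      unfolding W_def by (rule image_eqI[of _ _ 0]) simp_all
  next
    fix x y assume "x \<in> W" "y \<in> W"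
    then obtain a b where "x = C *v a - a" "y = C *v b - b"
      by (auto simp: W_def)
    then show "x + y \<in> W"
      unfolding W_def
      by (intro image_eqI[of _ _ "a + b"]) (simp_all add: matrix_vector_right_distrib)
  next
    fix c x assume "x \<in> W"
    then obtain a where "x = C *v a - a"
      by (auto simp: W_def)
    then show "c *s x \<in> W"
      unfolding W_def
      by (intro image_eqI[of _ _ "c *s a"])
        (simp_all add: vec.linear_scale[OF matrix_vector_mul_linear_gen]
          vec.scale_right_diff_distrib)
  qed
  have inv: "A *v v \<in> W" if "v \<in> W" for v
    using that by (auto simp: W_def comm matrix_vector_mult_diff_distrib)
  have no_eigenvector: "v = 0" if "v \<in> W" "A *v v = \<mu> *s v" for v \<mu>
  proof (rule ccontr)
    assume "v \<noteq> 0"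
    with that(2) ev have "exp (of_real t * \<mu>) = 1"
      by (auto simp: matrix_eigenvalue_def A_def)
    then have fixed: "C *v v = v"
      using one_param_subgroup_eigenvector[of X v \<mu> t] that(2) by (simp add: A_def C_def Y_def)
    obtain u where u: "v = C *v u - u"
      using \<open>v \<in> W\<close> by (auto simp: W_def)
    have "C *v u = u"
      using complex_orthogonal_matrix_fixed_difference[OF orth, of u] fixed u
      by (simp add: C_def)
    then show False
      using u \<open>v \<noteq> 0\<close> by simp
  qed
  have "w = 0" if "w \<in> W" for w
    using eigenvector_in_invariant_subspace[OF W inv that] no_eigenvector by blast
  from this[of "C *v u - u" for u] have "C *v u - u = 0" for u
    by (simp add: W_def)
  then have "C = mat 1"
    by (simp add: matrix_eq)
  then show "one_param_subgroup X t = mat 1"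
    by (simp add: C_def Y_def complex_matrix_eq_iff flip: complex_matrix_mat_1)
qed

lemma not_inj_one_param_subgroup_iff:
  fixes X :: "real ^ 'n ^ 'n"
  shows "\<not> inj (one_param_subgroup X) \<longleftrightarrow> (\<exists>T. T \<noteq> 0 \<and> one_param_subgroup X T = mat 1)"
proof
  assume "\<not> inj (one_param_subgroup X)"
  then obtain s t where "s \<noteq> t" "one_param_subgroup X s = one_param_subgroup X t"
    by (auto simp: inj_def)
  then have "one_param_subgroup X (s - t) = mat 1"
    using one_param_subgroup_add[of X s "- t"] one_param_subgroup_add[of X t "- t"] by simp
  then show "\<exists>T. T \<noteq> 0 \<and> one_param_subgroup X T = mat 1"
    using \<open>s \<noteq> t\<close> by (intro exI[of _ "s - t"]) simp
next
  assume "\<exists>T. T \<noteq> 0 \<and> one_param_subgroup X T = mat 1"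
  then show "\<not> inj (one_param_subgroup X)"
    by (metis injD one_param_subgroup_0)
qed

section \<open>Commensurable frequencies\<close>

lemma common_denominator:
  fixes Q :: "real set"
  assumes "finite Q" "Q \<subseteq> \<rat>"
  shows "\<exists>N::nat. N > 0 \<and> (\<forall>q\<in>Q. real N * q \<in> \<int>)"
  using assms
proof (induction Q rule: finite_induct)
  case empty
  then show ?case by auto
next
  case (insert x Q)
  then obtain N :: nat where N: "N > 0" "\<forall>q\<in>Q. real N * q \<in> \<int>"
    by auto
  obtain a b :: int where "b > 0" "x = of_int a / of_int b"
    using insert.prems by (auto elim: Rats_cases')
  then have b: "nat b > 0" "real (nat b) * x \<in> \<int>"
    by simp_all
  have "real (N * nat b) * q \<in> \<int>" if "q \<in> insert x Q" for q
  proof (cases "q = x")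
    case True
    then show ?thesis
      using Ints_mult[OF Ints_of_nat[of N] b(2)] by (simp add: mult_ac)
  next
    case False
    then have "real N * q \<in> \<int>"
      using that N by auto
    from Ints_mult[OF Ints_of_nat[of "nat b"] this] show ?thesis
      by (simp add: mult_ac)
  qed
  then show ?case
    using N(1) b(1) by (intro exI[of _ "N * nat b"]) auto
qed

text \<open>
  The two sides are linked by \<open>\<alpha> = 2\<pi>N/T\<close>, with \<open>N = 1\<close> when \<open>\<alpha>\<close> is found from
  \<open>T\<close>, and with \<open>N\<close> a common denominator of the ratios when \<open>T\<close> is found from \<open>\<alpha>\<close>.
\<close>

lemma common_period_iff_commensurable:
  fixes L :: "real set"
  assumes "finite L"
  shows "(\<exists>T. T \<noteq> 0 \<and> (\<forall>x\<in>L. exp (\<i> * of_real (T * x)) = 1)) \<longleftrightarrow>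
    (\<exists>\<alpha>. \<alpha> \<noteq> 0 \<and> (\<forall>x\<in>L. \<exists>q\<in>\<rat>. x = q * \<alpha>))"
proof (intro iffI; elim exE conjE)
  fix T :: real
  assume T: "T \<noteq> 0" "\<forall>x\<in>L. exp (\<i> * of_real (T * x)) = 1"
  have "\<exists>q\<in>\<rat>. x = q * (2 * pi / T)" if "x \<in> L" for x
  proof -
    have "exp (\<i> * of_real (T * x)) = 1"
      using T(2) that by blast
    then obtain n :: int where "T * x = of_int (2 * n) * pi"
      by (auto simp: exp_eq_1)
    then show ?thesis
      using T(1) by (intro bexI[of _ "of_int n"]) (auto simp: field_simps)
  qed
  then show "\<exists>\<alpha>. \<alpha> \<noteq> 0 \<and> (\<forall>x\<in>L. \<exists>q\<in>\<rat>. x = q * \<alpha>)"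
    using T(1) by (intro exI[of _ "2 * pi / T"]) simp
next
  fix \<alpha> :: real
  assume \<alpha>: "\<alpha> \<noteq> 0" "\<forall>x\<in>L. \<exists>q\<in>\<rat>. x = q * \<alpha>"
  have "(\<lambda>x. x / \<alpha>) ` L \<subseteq> \<rat>"
    using \<alpha> by auto
  then obtain N :: nat where N: "N > 0" "\<forall>x\<in>L. real N * (x / \<alpha>) \<in> \<int>"
    using common_denominator[of "(\<lambda>x. x / \<alpha>) ` L"] assms by auto
  have "exp (\<i> * of_real (2 * pi * N / \<alpha> * x)) = 1" if "x \<in> L" for x
  proof -
    have "real N * (x / \<alpha>) \<in> \<int>"
      using N(2) that by blast
    then obtain n where "real N * (x / \<alpha>) = of_int n"
      by (rule Ints_cases)
    then have "2 * pi * N / \<alpha> * x = of_int (2 * n) * pi"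
      using \<alpha>(1) by (simp add: field_simps)
    then show ?thesis
      by (auto simp: exp_eq_1)
  qed
  then show "\<exists>T. T \<noteq> 0 \<and> (\<forall>x\<in>L. exp (\<i> * of_real (T * x)) = 1)"
    using N(1) \<alpha>(1) by (intro exI[of _ "2 * pi * N / \<alpha>"]) simp
qed

text \<open>
  A nonzero rational \<open>\<alpha>\<close> may be replaced by \<open>1\<close>, which yields the two alternatives of the
  theorem.
\<close>

lemma commensurable_iff:
  fixes L :: "real set"
  shows "(\<exists>\<alpha>. \<alpha> \<noteq> 0 \<and> (\<forall>x\<in>L. \<exists>q\<in>\<rat>. x = q * \<alpha>)) \<longleftrightarrow>
    (\<forall>x\<in>L. x \<in> \<rat>) \<or> (\<exists>\<alpha>. \<alpha> \<notin> \<rat> \<and> (\<forall>x\<in>L. \<exists>q\<in>\<rat>. x = q * \<alpha>))"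
proof
  assume "\<exists>\<alpha>. \<alpha> \<noteq> 0 \<and> (\<forall>x\<in>L. \<exists>q\<in>\<rat>. x = q * \<alpha>)"
  then show "(\<forall>x\<in>L. x \<in> \<rat>) \<or> (\<exists>\<alpha>. \<alpha> \<notin> \<rat> \<and> (\<forall>x\<in>L. \<exists>q\<in>\<rat>. x = q * \<alpha>))"
    by (metis Rats_mult)
next
  assume "(\<forall>x\<in>L. x \<in> \<rat>) \<or> (\<exists>\<alpha>. \<alpha> \<notin> \<rat> \<and> (\<forall>x\<in>L. \<exists>q\<in>\<rat>. x = q * \<alpha>))"
  then show "\<exists>\<alpha>. \<alpha> \<noteq> 0 \<and> (\<forall>x\<in>L. \<exists>q\<in>\<rat>. x = q * \<alpha>)"
    by (metis Rats_0 mult.right_neutral zero_neq_one)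
qed

theorem corollary9:
  fixes X :: "real ^ 'n ^ 'n" and lam :: "nat \<Rightarrow> real" and l :: nat
  assumes "CARD('n) \<ge> 2"
    and "X \<in> so_algebra"
    and "X \<noteq> 0"
    and "{\<mu>. matrix_eigenvalue (complex_matrix X) \<mu> \<and> \<mu> \<noteq> 0}
      = (\<Union>j\<in>{1..l}. {\<i> * complex_of_real (lam j), - (\<i> * complex_of_real (lam j))})"
  shows "\<not> inj (one_param_subgroup X) \<longleftrightarrow>
      (\<forall>j\<in>{1..l}. lam j \<in> \<rat>) \<or>
      (\<exists>\<alpha>. \<alpha> \<notin> \<rat> \<and> (\<forall>j\<in>{1..l}. \<exists>q\<in>\<rat>. lam j = q * \<alpha>))"
proof -
  define L where "L = lam ` {1..l}"
  have "one_param_subgroup X T = mat 1 \<longleftrightarrow> (\<forall>x\<in>L. exp (\<i> * of_real (T * x)) = 1)" for T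
  proof -
    have "one_param_subgroup X T = mat 1 \<longleftrightarrow>
        (\<forall>\<mu>\<in>{\<mu>. matrix_eigenvalue (complex_matrix X) \<mu> \<and> \<mu> \<noteq> 0}. exp (of_real T * \<mu>) = 1)"
      unfolding one_param_subgroup_eq_mat_1_iff[OF assms(2)] by force
    also have "\<dots> \<longleftrightarrow> (\<forall>x\<in>L. exp (of_real T * (\<i> * of_real x)) = 1
        \<and> exp (of_real T * - (\<i> * of_real x)) = 1)"
      unfolding assms(4) L_def by auto
    also have "\<dots> \<longleftrightarrow> (\<forall>x\<in>L. exp (\<i> * of_real (T * x)) = 1)"
      by (simp add: exp_minus mult_ac)
    finally show ?thesis .
  qed
  then have "\<not> inj (one_param_subgroup X) \<longleftrightarrow>
      (\<exists>T. T \<noteq> 0 \<and> (\<forall>x\<in>L. exp (\<i> * of_real (T * x)) = 1))"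
    by (simp only: not_inj_one_param_subgroup_iff)
  also have "\<dots> \<longleftrightarrow> (\<exists>\<alpha>. \<alpha> \<noteq> 0 \<and> (\<forall>x\<in>L. \<exists>q\<in>\<rat>. x = q * \<alpha>))"
    by (rule common_period_iff_commensurable) (simp add: L_def)
  also have "\<dots> \<longleftrightarrow>
      (\<forall>x\<in>L. x \<in> \<rat>) \<or> (\<exists>\<alpha>. \<alpha> \<notin> \<rat> \<and> (\<forall>x\<in>L. \<exists>q\<in>\<rat>. x = q * \<alpha>))"
    by (rule commensurable_iff)
  finally show ?thesis
    by (simp add: L_def)
qed

end
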